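(* Let $\mathrm L$ be a semilinear core expansion of $\mathrm{MTL}$ that is not an $\mathrm{SMTL}$ logic. Then: 1. $\circ$ satisfies the propagation property in $\mathrm L_\circ$ with respect to $\{\wedge,\to\}$: for each $\#\in\{\wedge,\to\}$ and all formulas $\varphi,\psi$, $\vdash_{\mathrm L_\circ}(\circ\varphi\wedge\circ\psi)\to\circ(\varphi\#\psi)$. 2. $\circ$ satisfies the propagation property in each of the logics $\mathrm L^{\neg\neg}_\circ$, $\mathrm L^{\min}_\circ$ and $\mathrm L^{\max}_\circ$ with respect to $\{\wedge,\&,\to\}$: if $\mathrm S$ is any of these three logics, then for each $\#\in\{\wedge,\&,\to\}$ and all formulas $\varphi,\psi$, $\vdash_{\mathrm S}(\circ\varphi\wedge\circ\psi)\to\circ(\varphi\#\psi)$.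
   Context: $\mathrm{MTL}$: formulas are built from countably many propositional variables with binary connectives $\wedge,\&,\to$ and the constant $\overline 0$; $\neg\varphi:=\varphi\to\overline 0$, $\overline 1:=\neg\overline 0$, $\varphi\vee\psi:=((\varphi\to\psi)\to\psi)\wedge((\psi\to\varphi)\to\varphi)$, $\varphi\leftrightarrow\psi:=(\varphi\to\psi)\wedge(\psi\to\varphi)$. Its axiom schemata are $(\varphi\to\psi)\to((\psi\to\chi)\to(\varphi\to\chi))$; $\varphi\&\psi\to\varphi$; $\varphi\&\psi\to\psi\&\varphi$; $\varphi\wedge\psi\to\varphi$; $\varphi\wedge\psi\to\psi\wedge\varphi$; $\varphi\&(\varphi\to\psi)\to\varphi\wedge\psi$; $(\varphi\to(\psi\to\chi))\to(\varphi\&\psi\to\chi)$; $(\varphi\&\psi\to\chi)\to(\varphi\to(\psi\to\chi))$; $((\varphi\to\psi)\to\chi)\to(((\psi\to\varphi)\to\chi)\to\chi)$; $\overline 0\to\varphi$; its only rule is modus ponens. An $\mathrm{MTL}$-algebra is a commutative bounded integral residuated lattice $\langle A,\wedge,\vee,\&,\to,0,1\rangle$ with $(x\to y)\vee(y\to x)=1$. A core expansion of $\mathrm{MTL}$ is a finitary logic $\mathrm L$ obtained from $\mathrm{MTL}$ by possibly adding new connectives, axiom schemata and finitary rule schemata, such that for each new $n$-ary connective $c$ and each argument place, $\varphi\to\psi,\psi\to\varphi\vdash_{\mathrm L}c(\ldots,\varphi,\ldots)\to c(\ldots,\psi,\ldots)$. An $\mathrm L$-algebra is an $\mathrm{MTL}$-algebra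 with operations interpreting the new connectives such that, under every evaluation, all axioms of $\mathrm L$ get value $1$ and all rules of $\mathrm L$ preserve the value $1$; an $\mathrm L$-chain is a linearly ordered one. $\mathrm L$ is semilinear if it is strongly complete w.r.t. $\mathrm L$-chains. "$\mathrm L$ is not an $\mathrm{SMTL}$ logic" means that $\mathrm L$ does not prove the schema $\varphi\wedge\neg\varphi\to\overline 0$. The logic $\mathrm L_\circ$ is the expansion of (an axiomatization of) $\mathrm L$ with a new unary connective $\circ$, the axioms $\neg(\varphi\wedge\neg\varphi\wedge\circ\varphi)$, $\circ\overline 1$, $\circ\overline 0$, and the rules (Cong): from $(\varphi\leftrightarrow\psi)\vee\delta$ derive $(\circ\varphi\leftrightarrow\circ\psi)\vee\delta$; (Coh): from $(\neg\neg\varphi\wedge(\varphi\to\psi))\vee\delta$ derive $(\circ\varphi\to\circ\psi)\vee\delta$ (all schemata being in the expanded language). $\mathrm L^{\neg\neg}_\circ$ is $\mathrm L_\circ$ plus the rule "from $\neg\neg\varphi$ derive $\varphi$"; $\mathrm L^{\min}_\circ$ is $\mathrm L_\circ$ plus the axiom $\varphi\vee\neg\varphi\vee\neg\circ\varphi$; $\mathrm L^{\max}_\circ$ is $\mathrm L_\circ$ plus the rule "from $\neg\neg\varphi\vee\delta$ derive $\circ\varphi\vee\delta$". *)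

theory Defs
  imports Main
begin

section \<open>Formulas, schemata and derivations\<close>

datatype 'c fm =
    Var nat
  | Zero                          (\<open>\<^bold>0\<close>)
  | And "'c fm" "'c fm"           (infixr \<open>\<^bold>\<and>\<close> 55)
  | Amp "'c fm" "'c fm"           (infixr \<open>\<^bold>&\<close> 55)
  | Imp "'c fm" "'c fm"           (infixr \<open>\<^bold>\<rightarrow>\<close> 50)
  | Conn 'c "'c fm list"

definition Neg :: "'c fm \<Rightarrow> 'c fm" (\<open>\<^bold>\<not> _\<close> [60] 60)
  where "\<^bold>\<not> \<phi> = (\<phi> \<^bold>\<rightarrow> \<^bold>0)"

definition One :: "'c fm" (\<open>\<^bold>1\<close>)
  where "\<^bold>1 = \<^bold>\<not> \<^bold>0"

definition Or :: "'c fm \<Rightarrow> 'c fm \<Rightarrow> 'c fm" (infixr \<open>\<^bold>\<or>\<close> 53)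
  where "\<phi> \<^bold>\<or> \<psi> = (((\<phi> \<^bold>\<rightarrow> \<psi>) \<^bold>\<rightarrow> \<psi>) \<^bold>\<and> ((\<psi> \<^bold>\<rightarrow> \<phi>) \<^bold>\<rightarrow> \<phi>))"

definition Iff :: "'c fm \<Rightarrow> 'c fm \<Rightarrow> 'c fm" (infix \<open>\<^bold>\<leftrightarrow>\<close> 50)
  where "(\<phi> \<^bold>\<leftrightarrow> \<psi>) = ((\<phi> \<^bold>\<rightarrow> \<psi>) \<^bold>\<and> (\<psi> \<^bold>\<rightarrow> \<phi>))"

primrec subst :: "(nat \<Rightarrow> 'c fm) \<Rightarrow> 'c fm \<Rightarrow> 'c fm" where
  "subst \<sigma> (Var n) = \<sigma> n"
| "subst \<sigma> \<^bold>0 = \<^bold>0"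
| "subst \<sigma> (\<phi> \<^bold>\<and> \<psi>) = (subst \<sigma> \<phi> \<^bold>\<and> subst \<sigma> \<psi>)"
| "subst \<sigma> (\<phi> \<^bold>& \<psi>) = (subst \<sigma> \<phi> \<^bold>& subst \<sigma> \<psi>)"
| "subst \<sigma> (\<phi> \<^bold>\<rightarrow> \<psi>) = (subst \<sigma> \<phi> \<^bold>\<rightarrow> subst \<sigma> \<psi>)"
| "subst \<sigma> (Conn c ts) = Conn c (map (subst \<sigma>) ts)"

text \<open>
  A logic is given by an axiomatization. The new connectives are the \<open>c\<close> with
  \<open>arity c \<noteq> None\<close>, so there may be none. Axiom and rule schemata are formulas
  whose propositional variables act as metavariables; a rule is a finite list of
  premises with a conclusion.
\<close>

record 'c calculus =
  arity  :: "'c \<Rightarrow> nat option"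
  axioms :: "'c fm set"
  rules  :: "('c fm list \<times> 'c fm) set"

fun wff :: "('c \<Rightarrow> nat option) \<Rightarrow> 'c fm \<Rightarrow> bool" where
  "wff ar (Var n) \<longleftrightarrow> True"
| "wff ar \<^bold>0 \<longleftrightarrow> True"
| "wff ar (\<phi> \<^bold>\<and> \<psi>) \<longleftrightarrow> wff ar \<phi> \<and> wff ar \<psi>"
| "wff ar (\<phi> \<^bold>& \<psi>) \<longleftrightarrow> wff ar \<phi> \<and> wff ar \<psi>"
| "wff ar (\<phi> \<^bold>\<rightarrow> \<psi>) \<longleftrightarrow> wff ar \<phi> \<and> wff ar \<psi>"
| "wff ar (Conn c ts) \<longleftrightarrow> ar c = Some (length ts) \<and> (\<forall>t\<in>set ts. wff ar t)"

definition Fm :: "'c calculus \<Rightarrow> 'c fm set"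
  where "Fm L = {\<phi>. wff (arity L) \<phi>}"

inductive derivable :: "'c calculus \<Rightarrow> 'c fm set \<Rightarrow> 'c fm \<Rightarrow> bool"
  for L :: "'c calculus" and \<Gamma> :: "'c fm set"
where
  hyp: "\<phi> \<in> \<Gamma> \<Longrightarrow> derivable L \<Gamma> \<phi>"
| ax: "\<alpha> \<in> axioms L \<Longrightarrow> range \<sigma> \<subseteq> Fm L \<Longrightarrow> derivable L \<Gamma> (subst \<sigma> \<alpha>)"
| rl: "(\<pi>s, \<gamma>) \<in> rules L \<Longrightarrow> range \<sigma> \<subseteq> Fm L \<Longrightarrow>
       (\<And>\<pi>. \<pi> \<in> set \<pi>s \<Longrightarrow> derivable L \<Gamma> (subst \<sigma> \<pi>)) \<Longrightarrow> derivable L \<Gamma> (subst \<sigma> \<gamma>)"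


section \<open>Core expansions of MTL\<close>

definition mtl_axioms :: "'c fm set" where
  "mtl_axioms = (let \<phi> = Var 0; \<psi> = Var 1; \<chi> = Var 2 in
    { (\<phi> \<^bold>\<rightarrow> \<psi>) \<^bold>\<rightarrow> ((\<psi> \<^bold>\<rightarrow> \<chi>) \<^bold>\<rightarrow> (\<phi> \<^bold>\<rightarrow> \<chi>)),
      (\<phi> \<^bold>& \<psi>) \<^bold>\<rightarrow> \<phi>,
      (\<phi> \<^bold>& \<psi>) \<^bold>\<rightarrow> (\<psi> \<^bold>& \<phi>),
      (\<phi> \<^bold>\<and> \<psi>) \<^bold>\<rightarrow> \<phi>,
      (\<phi> \<^bold>\<and> \<psi>) \<^bold>\<rightarrow> (\<psi> \<^bold>\<and> \<phi>),
      (\<phi> \<^bold>& (\<phi> \<^bold>\<rightarrow> \<psi>)) \<^bold>\<rightarrow> (\<phi> \<^bold>\<and> \<psi>),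
      (\<phi> \<^bold>\<rightarrow> (\<psi> \<^bold>\<rightarrow> \<chi>)) \<^bold>\<rightarrow> ((\<phi> \<^bold>& \<psi>) \<^bold>\<rightarrow> \<chi>),
      ((\<phi> \<^bold>& \<psi>) \<^bold>\<rightarrow> \<chi>) \<^bold>\<rightarrow> (\<phi> \<^bold>\<rightarrow> (\<psi> \<^bold>\<rightarrow> \<chi>)),
      ((\<phi> \<^bold>\<rightarrow> \<psi>) \<^bold>\<rightarrow> \<chi>) \<^bold>\<rightarrow> (((\<psi> \<^bold>\<rightarrow> \<phi>) \<^bold>\<rightarrow> \<chi>) \<^bold>\<rightarrow> \<chi>),
      \<^bold>0 \<^bold>\<rightarrow> \<phi> })"

definition modus_ponens :: "'c fm list \<times> 'c fm"
  where "modus_ponens = ([Var 0, Var 0 \<^bold>\<rightarrow> Var 1], Var 1)"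

definition core_expansion :: "'c calculus \<Rightarrow> bool" where
  "core_expansion L \<longleftrightarrow>
     mtl_axioms \<subseteq> axioms L \<and> modus_ponens \<in> rules L \<and>
     axioms L \<subseteq> Fm L \<and>
     (\<forall>(\<pi>s, \<gamma>) \<in> rules L. set \<pi>s \<subseteq> Fm L \<and> \<gamma> \<in> Fm L) \<and>
     (\<forall>c n ts i. \<forall>\<phi>\<in>Fm L. \<forall>\<psi>\<in>Fm L.
        arity L c = Some n \<and> length ts = n \<and> set ts \<subseteq> Fm L \<and> i < n \<longrightarrow>
        derivable L {\<phi> \<^bold>\<rightarrow> \<psi>, \<psi> \<^bold>\<rightarrow> \<phi>} (Conn c (ts[i := \<phi>]) \<^bold>\<rightarrow> Conn c (ts[i := \<psi>])))"

definition smtl_logic :: "'c calculus \<Rightarrow> bool"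
  where "smtl_logic L \<longleftrightarrow> (\<forall>\<phi>\<in>Fm L. derivable L {} ((\<phi> \<^bold>\<and> \<^bold>\<not> \<phi>) \<^bold>\<rightarrow> \<^bold>0))"


section \<open>Algebras and semilinearity\<close>

record ('a, 'c) alg =
  univ :: "'a set"
  meet :: "'a \<Rightarrow> 'a \<Rightarrow> 'a"
  join :: "'a \<Rightarrow> 'a \<Rightarrow> 'a"
  fus  :: "'a \<Rightarrow> 'a \<Rightarrow> 'a"
  res  :: "'a \<Rightarrow> 'a \<Rightarrow> 'a"
  falsum :: 'a
  verum :: 'a
  opn  :: "'c \<Rightarrow> 'a list \<Rightarrow> 'a"

definition leq :: "('a, 'c) alg \<Rightarrow> 'a \<Rightarrow> 'a \<Rightarrow> bool"
  where "leq A x y \<longleftrightarrow> meet A x y = x"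

definition bounded_lattice_alg :: "('a, 'c) alg \<Rightarrow> bool" where
  "bounded_lattice_alg A \<longleftrightarrow>
     falsum A \<in> univ A \<and> verum A \<in> univ A \<and>
     (\<forall>x\<in>univ A. \<forall>y\<in>univ A. meet A x y \<in> univ A \<and> join A x y \<in> univ A) \<and>
     (\<forall>x\<in>univ A. \<forall>y\<in>univ A. meet A x y = meet A y x \<and> join A x y = join A y x) \<and>
     (\<forall>x\<in>univ A. \<forall>y\<in>univ A. \<forall>z\<in>univ A.
        meet A (meet A x y) z = meet A x (meet A y z) \<and>
        join A (join A x y) z = join A x (join A y z)) \<and>
     (\<forall>x\<in>univ A. \<forall>y\<in>univ A. meet A x (join A x y) = x \<and> join A x (meet A x y) = x) \<and>
     (\<forall>x\<in>univ A. leq A (falsum A) x \<and> leq A x (verum A))"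

text \<open>Integrality is built in: the unit of the monoid is the top element.\<close>

definition residuated_lattice :: "('a, 'c) alg \<Rightarrow> bool" where
  "residuated_lattice A \<longleftrightarrow>
     bounded_lattice_alg A \<and>
     (\<forall>x\<in>univ A. \<forall>y\<in>univ A. fus A x y \<in> univ A \<and> res A x y \<in> univ A) \<and>
     (\<forall>x\<in>univ A. \<forall>y\<in>univ A. fus A x y = fus A y x) \<and>
     (\<forall>x\<in>univ A. \<forall>y\<in>univ A. \<forall>z\<in>univ A. fus A (fus A x y) z = fus A x (fus A y z)) \<and>
     (\<forall>x\<in>univ A. fus A x (verum A) = x) \<and>
     (\<forall>x\<in>univ A. \<forall>y\<in>univ A. \<forall>z\<in>univ A. leq A (fus A x y) z \<longleftrightarrow> leq A x (res A y z))"

definition mtl_algebra :: "('a, 'c) alg \<Rightarrow> bool" where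
  "mtl_algebra A \<longleftrightarrow>
     residuated_lattice A \<and>
     (\<forall>x\<in>univ A. \<forall>y\<in>univ A. join A (res A x y) (res A y x) = verum A)"

primrec val :: "('a, 'c) alg \<Rightarrow> (nat \<Rightarrow> 'a) \<Rightarrow> 'c fm \<Rightarrow> 'a" where
  "val A e (Var n) = e n"
| "val A e \<^bold>0 = falsum A"
| "val A e (\<phi> \<^bold>\<and> \<psi>) = meet A (val A e \<phi>) (val A e \<psi>)"
| "val A e (\<phi> \<^bold>& \<psi>) = fus A (val A e \<phi>) (val A e \<psi>)"
| "val A e (\<phi> \<^bold>\<rightarrow> \<psi>) = res A (val A e \<phi>) (val A e \<psi>)"
| "val A e (Conn c ts) = opn A c (map (val A e) ts)"

definition L_algebra :: "'c calculus \<Rightarrow> ('a, 'c) alg \<Rightarrow> bool" where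
  "L_algebra L A \<longleftrightarrow>
     mtl_algebra A \<and>
     (\<forall>c xs. arity L c = Some (length xs) \<and> set xs \<subseteq> univ A \<longrightarrow> opn A c xs \<in> univ A) \<and>
     (\<forall>e. range e \<subseteq> univ A \<longrightarrow>
        (\<forall>\<alpha>\<in>axioms L. val A e \<alpha> = verum A) \<and>
        (\<forall>(\<pi>s, \<gamma>)\<in>rules L. (\<forall>\<pi>\<in>set \<pi>s. val A e \<pi> = verum A) \<longrightarrow> val A e \<gamma> = verum A))"

definition L_chain :: "'c calculus \<Rightarrow> ('a, 'c) alg \<Rightarrow> bool" where
  "L_chain L A \<longleftrightarrow> L_algebra L A \<and> (\<forall>x\<in>univ A. \<forall>y\<in>univ A. leq A x y \<or> leq A y x)"

definition chain_consequence ::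
    "'a itself \<Rightarrow> 'c calculus \<Rightarrow> 'c fm set \<Rightarrow> 'c fm \<Rightarrow> bool" where
  "chain_consequence (_ :: 'a itself) L \<Gamma> \<phi> \<longleftrightarrow>
     (\<forall>(A :: ('a, 'c) alg) e. L_chain L A \<and> range e \<subseteq> univ A \<and>
        (\<forall>\<gamma>\<in>\<Gamma>. val A e \<gamma> = verum A) \<longrightarrow> val A e \<phi> = verum A)"

text \<open>
  One cannot quantify over all types inside a formula, so the chains range over
  those whose universe is a set of formulas. Nothing is lost: the values of the
  formulas under an evaluation form a subalgebra, which can be copied into the
  type of formulas (lemma \<open>chain_consequence_any_type\<close> below).
\<close>

definition semilinear :: "'c calculus \<Rightarrow> bool" where
  "semilinear L \<longleftrightarrow>
     (\<forall>\<Gamma> \<phi>. \<Gamma> \<subseteq> Fm L \<and> \<phi> \<in> Fm L \<longrightarrow>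
        (derivable L \<Gamma> \<phi> \<longleftrightarrow> chain_consequence TYPE('c fm) L \<Gamma> \<phi>))"

lemma val_in_univ:
  assumes "L_algebra L A" "range e \<subseteq> univ A" "\<phi> \<in> Fm L"
  shows "val A e \<phi> \<in> univ A"
proof -
  have "wff (arity L) \<phi>" using assms(3) by (simp add: Fm_def)
  then show ?thesis
  proof (induction \<phi>)
    case (Conn c ts)
    have "arity L c = Some (length (map (val A e) ts))" using Conn.prems by simp
    moreover have "set (map (val A e) ts) \<subseteq> univ A" using Conn by auto
    ultimately have "opn A c (map (val A e) ts) \<in> univ A"
      using assms(1) unfolding L_algebra_def by blast
    then show ?case by simp
  qed (use assms(1,2) in \<open>auto simp: L_algebra_def mtl_algebra_def residuated_lattice_def
      bounded_lattice_alg_def\<close>)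
qed

lemma chain_consequence_any_type:
  fixes L :: "'c calculus"
  assumes core: "core_expansion L"
    and cons: "chain_consequence TYPE('c fm) L \<Gamma> \<phi>"
    and \<Gamma>: "\<Gamma> \<subseteq> Fm L" and \<phi>: "\<phi> \<in> Fm L"
  shows "chain_consequence TYPE('a) L \<Gamma> \<phi>"
  unfolding chain_consequence_def
proof (intro allI impI, elim conjE)
  fix A :: "('a, 'c) alg" and e
  assume A: "L_chain L A" and e: "range e \<subseteq> univ A" and top: "\<forall>\<gamma>\<in>\<Gamma>. val A e \<gamma> = verum A"
  have alg: "L_algebra L A" and tot: "\<forall>x\<in>univ A. \<forall>y\<in>univ A. leq A x y \<or> leq A y x"
    using A by (auto simp: L_chain_def)
  have rl: "residuated_lattice A" and bl: "bounded_lattice_alg A"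
    and pre: "\<forall>x\<in>univ A. \<forall>y\<in>univ A. join A (res A x y) (res A y x) = verum A"
    using alg unfolding L_algebra_def mtl_algebra_def residuated_lattice_def by blast+
  define v where "v = val A e"
  define S where "S = v ` Fm L"
  define h where "h = inv_into (Fm L) v"
  have SA: "x \<in> S \<Longrightarrow> x \<in> univ A" for x
    using val_in_univ[OF alg e] by (auto simp: S_def v_def)
  have vh: "x \<in> S \<Longrightarrow> v (h x) = x" for x
    by (simp add: S_def h_def f_inv_into_f)
  have bot: "falsum A \<in> S"
    unfolding S_def v_def by (rule image_eqI[of _ _ Zero]) (auto simp: Fm_def)
  have meet: "meet A x y \<in> S" if xy: "x \<in> S" "y \<in> S" for x y
  proof -
    obtain \<alpha> \<beta> where "\<alpha> \<in> Fm L" "\<beta> \<in> Fm L" "x = v \<alpha>" "y = v \<beta>" using xy by (auto simp: S_def)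
    then show ?thesis
      unfolding S_def v_def by (intro image_eqI[of _ _ "And \<alpha> \<beta>"]) (auto simp: Fm_def)
  qed
  have fus: "fus A x y \<in> S" if xy: "x \<in> S" "y \<in> S" for x y
  proof -
    obtain \<alpha> \<beta> where "\<alpha> \<in> Fm L" "\<beta> \<in> Fm L" "x = v \<alpha>" "y = v \<beta>" using xy by (auto simp: S_def)
    then show ?thesis
      unfolding S_def v_def by (intro image_eqI[of _ _ "Amp \<alpha> \<beta>"]) (auto simp: Fm_def)
  qed
  have res: "res A x y \<in> S" if xy: "x \<in> S" "y \<in> S" for x y
  proof -
    obtain \<alpha> \<beta> where "\<alpha> \<in> Fm L" "\<beta> \<in> Fm L" "x = v \<alpha>" "y = v \<beta>" using xy by (auto simp: S_def)
    then show ?thesis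
      unfolding S_def v_def by (intro image_eqI[of _ _ "Imp \<alpha> \<beta>"]) (auto simp: Fm_def)
  qed
  have join: "join A x y \<in> S" if xy: "x \<in> S" "y \<in> S" for x y
  proof -
    have "leq A x y \<or> leq A y x" using tot SA xy by blast
    then have "join A x y = y \<or> join A x y = x"
      using bl SA[OF xy(1)] SA[OF xy(2)] unfolding bounded_lattice_alg_def leq_def by metis
    then show ?thesis using xy by auto
  qed
  have topS: "verum A \<in> S"
  proof -
    have b: "falsum A \<in> univ A" "verum A \<in> univ A" and r: "res A (falsum A) (falsum A) \<in> univ A"
      using rl unfolding residuated_lattice_def bounded_lattice_alg_def by blast+
    have "fus A (verum A) (falsum A) = falsum A" using rl b unfolding residuated_lattice_def by metis
    then have "leq A (fus A (verum A) (falsum A)) (falsum A)"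
      using bl b unfolding bounded_lattice_alg_def by metis
    then have "leq A (verum A) (res A (falsum A) (falsum A))"
      using rl b unfolding residuated_lattice_def by metis
    then have "res A (falsum A) (falsum A) = verum A"
      using bl b r unfolding bounded_lattice_alg_def leq_def by metis
    then show ?thesis using res[OF bot bot] by simp
  qed
  have opn: "opn A c xs \<in> S" if c: "arity L c = Some (length xs)" and xs: "set xs \<subseteq> S" for c xs
  proof -
    have "h x \<in> Fm L" if "x \<in> S" for x using that by (simp add: S_def h_def inv_into_into)
    then have "Conn c (map h xs) \<in> Fm L" using c xs by (auto simp: Fm_def)
    moreover have "v (Conn c (map h xs)) = opn A c (map (v \<circ> h) xs)"
      by (simp add: v_def)
    moreover have "map (v \<circ> h) xs = xs" using xs vh by (intro map_idI) auto
    ultimately show ?thesis unfolding S_def by (metis imageI)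
  qed
  define B :: "('c fm, 'c) alg" where
    "B = \<lparr> univ = h ` S, meet = (\<lambda>p q. h (meet A (v p) (v q))), join = (\<lambda>p q. h (join A (v p) (v q))),
       fus = (\<lambda>p q. h (fus A (v p) (v q))), res = (\<lambda>p q. h (res A (v p) (v q))),
       falsum = h (falsum A), verum = h (verum A), opn = (\<lambda>c ps. h (opn A c (map v ps))) \<rparr>"
  have hinj: "h x = h y \<longleftrightarrow> x = y" if "x \<in> S" "y \<in> S" for x y using vh that by metis
  note [simp] = bot meet fus res join topS vh hinj
  have leqB: "leq B (h x) (h y) \<longleftrightarrow> leq A x y" if "x \<in> S" "y \<in> S" for x y
    using that by (simp add: leq_def B_def)
  have uB: "univ B = h ` S" "falsum B = h (falsum A)" "verum B = h (verum A)"
    by (simp_all add: B_def)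
  have opB: "meet B (h x) (h y) = h (meet A x y)" "join B (h x) (h y) = h (join A x y)"
    "fus B (h x) (h y) = h (fus A x y)" "res B (h x) (h y) = h (res A x y)"
    if "x \<in> S" "y \<in> S" for x y
    using that by (simp_all add: B_def)
  have ballB: "(\<forall>p\<in>univ B. P p) \<longleftrightarrow> (\<forall>x\<in>S. P (h x))" for P
    by (simp add: uB)
  have memB: "x \<in> S \<Longrightarrow> h x \<in> univ B" for x
    by (simp add: uB)
  have blA: "meet A x y = meet A y x" "join A x y = join A y x"
    "meet A x (join A x y) = x" "join A x (meet A x y) = x"
    "leq A (falsum A) x" "leq A x (verum A)" if "x \<in> S" "y \<in> S" for x y
    using bl SA[OF that(1)] SA[OF that(2)] unfolding bounded_lattice_alg_def by meson+
  have blA3: "meet A (meet A x y) z = meet A x (meet A y z)"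
    "join A (join A x y) z = join A x (join A y z)" if "x \<in> S" "y \<in> S" "z \<in> S" for x y z
    using bl SA[OF that(1)] SA[OF that(2)] SA[OF that(3)] unfolding bounded_lattice_alg_def by meson+
  have blB: "bounded_lattice_alg B"
    unfolding bounded_lattice_alg_def ballB uB(2,3)
    by (intro conjI ballI) (simp_all add: memB opB leqB blA(3-6) blA3, (simp add: blA(1,2))+)
  have rlA: "fus A x y = fus A y x" "fus A x (verum A) = x" if "x \<in> S" "y \<in> S" for x y
    using rl SA[OF that(1)] SA[OF that(2)] unfolding residuated_lattice_def by meson+
  have rlA3: "fus A (fus A x y) z = fus A x (fus A y z)"
    "leq A (fus A x y) z \<longleftrightarrow> leq A x (res A y z)" if "x \<in> S" "y \<in> S" "z \<in> S" for x y z
    using rl SA[OF that(1)] SA[OF that(2)] SA[OF that(3)] unfolding residuated_lattice_def by meson+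
  have rlB: "residuated_lattice B"
    unfolding residuated_lattice_def ballB uB(2,3)
    by (intro conjI ballI blB) (simp_all add: memB opB leqB rlA(2) rlA3, (simp add: rlA(1))+)
  have preA: "join A (res A x y) (res A y x) = verum A" if "x \<in> S" "y \<in> S" for x y
    using pre SA[OF that(1)] SA[OF that(2)] by meson
  have mtlB: "mtl_algebra B"
    unfolding mtl_algebra_def ballB uB(2,3)
    by (intro conjI ballI rlB) (simp add: opB preA)
  have opnB: "opn B c ps \<in> univ B" if "arity L c = Some (length ps)" "set ps \<subseteq> univ B" for c ps
  proof -
    have "set (map v ps) \<subseteq> S" using that(2) by (auto simp: B_def)
    then show ?thesis using opn[of c "map v ps"] that(1) by (simp add: B_def)
  qed
  have valB: "val B f \<alpha> = h (val A (v \<circ> f) \<alpha>) \<and> val A (v \<circ> f) \<alpha> \<in> S"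
    if f: "range f \<subseteq> univ B" and \<alpha>: "\<alpha> \<in> Fm L" for f \<alpha>
  proof -
    have "wff (arity L) \<alpha>" using \<alpha> by (simp add: Fm_def)
    then show ?thesis
    proof (induction \<alpha>)
      case (Var n)
      have "f n \<in> h ` S" using f by (auto simp: B_def)
      then show ?case by auto
    next
      case (Conn c ts)
      let ?xs = "map (val A (v \<circ> f)) ts"
      have IH: "val B f t = h (val A (v \<circ> f) t)" "val A (v \<circ> f) t \<in> S" if "t \<in> set ts" for t
        using Conn.IH[OF that] Conn.prems that by (simp_all del: comp_apply)
      have xs: "set ?xs \<subseteq> S" using IH(2) by (metis (no_types, lifting) image_subsetI set_map)
      have ar: "arity L c = Some (length ?xs)" using Conn.prems by simp
      have "map v (map (val B f) ts) = ?xs"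
        unfolding map_map using IH vh by (intro map_cong[OF refl]) (metis comp_apply)
      moreover have "opn B c ps = h (opn A c (map v ps))" for ps by (simp add: B_def)
      ultimately have "val B f (Conn c ts) = h (opn A c ?xs)" by (simp only: val.simps)
      then show ?case using opn[OF ar xs] by (simp only: val.simps simp_thms)
    qed (auto simp: B_def)
  qed
  have ran: "range (v \<circ> f) \<subseteq> univ A" if "range f \<subseteq> univ B" for f
  proof (rule image_subsetI)
    fix n
    have "f n \<in> h ` S" using that by (auto simp: B_def)
    then show "(v \<circ> f) n \<in> univ A" using SA by auto
  qed
  have topB: "val B f \<alpha> = verum B \<longleftrightarrow> val A (v \<circ> f) \<alpha> = verum A"
    if "range f \<subseteq> univ B" "\<alpha> \<in> Fm L" for f \<alpha>
    using valB[OF that] by (simp add: B_def)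
  have axB: "val B f \<alpha> = verum B" if f: "range f \<subseteq> univ B" and a: "\<alpha> \<in> axioms L" for f \<alpha>
  proof -
    have "\<alpha> \<in> Fm L" using core a by (auto simp: core_expansion_def)
    moreover have "val A (v \<circ> f) \<alpha> = verum A" using alg ran[OF f] a unfolding L_algebra_def by blast
    ultimately show ?thesis using topB[OF f] by blast
  qed
  have rlsB: "val B f \<gamma> = verum B"
    if f: "range f \<subseteq> univ B" and r: "(\<pi>s, \<gamma>) \<in> rules L" and p: "\<forall>\<pi>\<in>set \<pi>s. val B f \<pi> = verum B"
    for f \<pi>s \<gamma>
  proof -
    have w: "set \<pi>s \<subseteq> Fm L" "\<gamma> \<in> Fm L" using core r by (auto simp: core_expansion_def)
    then have "\<forall>\<pi>\<in>set \<pi>s. val A (v \<circ> f) \<pi> = verum A" using p topB[OF f] by blast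
    then have "val A (v \<circ> f) \<gamma> = verum A" using alg ran[OF f] r unfolding L_algebra_def by blast
    then show ?thesis using w topB[OF f] by blast
  qed
  have "L_algebra L B"
    unfolding L_algebra_def
    by (intro conjI allI impI ballI mtlB) (auto intro: opnB axB rlsB)
  then have chB: "L_chain L B"
    unfolding L_chain_def ballB
  proof (intro conjI ballI)
    fix x y assume xy: "x \<in> S" "y \<in> S"
    show "leq B (h x) (h y) \<or> leq B (h y) (h x)"
      using tot SA[OF xy(1)] SA[OF xy(2)] unfolding leqB[OF xy] leqB[OF xy(2,1)] by blast
  qed
  define f where "f = (\<lambda>n. h (e n))"
  have eS: "e n \<in> S" for n
    unfolding S_def v_def by (rule image_eqI[of _ _ "Var n"]) (auto simp: Fm_def)
  have f: "range f \<subseteq> univ B" using eS by (auto simp: f_def B_def)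
  have ve: "v \<circ> f = e" using eS by (auto simp: f_def)
  have "\<forall>\<gamma>\<in>\<Gamma>. val B f \<gamma> = verum B" using top topB[OF f] \<Gamma> unfolding ve by blast
  then have "val B f \<phi> = verum B" using cons chB f unfolding chain_consequence_def by blast
  then show "val A e \<phi> = verum A" using topB[OF f \<phi>] unfolding ve by blast
qed

section \<open>Logics with a consistency operator\<close>

datatype 'c with_circ = Circ | Old 'c

abbreviation circ :: "'c with_circ fm \<Rightarrow> 'c with_circ fm" (\<open>\<^bold>\<circ> _\<close> [60] 60)
  where "\<^bold>\<circ> \<phi> \<equiv> Conn Circ [\<phi>]"

text \<open>
  The schemata of \<open>L\<close> are only renamed by \<open>map_fm Old\<close>; as \<open>derivable\<close> instantiates
  schemata with all formulas of the logic at hand, they apply to the expanded language.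
\<close>

definition circ_logic :: "'c calculus \<Rightarrow> 'c with_circ calculus" where
  "circ_logic L = (let \<phi> = Var 0; \<psi> = Var 1; \<delta> = Var 2 in
    \<lparr> arity = (\<lambda>c. case c of Circ \<Rightarrow> Some 1 | Old c' \<Rightarrow> arity L c'),
      axioms = map_fm Old ` axioms L \<union>
        { \<^bold>\<not> (\<phi> \<^bold>\<and> \<^bold>\<not> \<phi> \<^bold>\<and> \<^bold>\<circ> \<phi>), \<^bold>\<circ> \<^bold>1, \<^bold>\<circ> \<^bold>0 },
      rules = map_prod (map (map_fm Old)) (map_fm Old) ` rules L \<union>
        { ([(\<phi> \<^bold>\<leftrightarrow> \<psi>) \<^bold>\<or> \<delta>], (\<^bold>\<circ> \<phi> \<^bold>\<leftrightarrow> \<^bold>\<circ> \<psi>) \<^bold>\<or> \<delta>),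
          ([(\<^bold>\<not> \<^bold>\<not> \<phi> \<^bold>\<and> (\<phi> \<^bold>\<rightarrow> \<psi>)) \<^bold>\<or> \<delta>], (\<^bold>\<circ> \<phi> \<^bold>\<rightarrow> \<^bold>\<circ> \<psi>) \<^bold>\<or> \<delta>) } \<rparr>)"

definition circ_logic_nn :: "'c calculus \<Rightarrow> 'c with_circ calculus" where
  "circ_logic_nn L = (circ_logic L)
     \<lparr> rules := rules (circ_logic L) \<union> { ([\<^bold>\<not> \<^bold>\<not> (Var 0)], Var 0) } \<rparr>"

definition circ_logic_min :: "'c calculus \<Rightarrow> 'c with_circ calculus" where
  "circ_logic_min L = (circ_logic L)
     \<lparr> axioms := axioms (circ_logic L) \<union> { Var 0 \<^bold>\<or> \<^bold>\<not> (Var 0) \<^bold>\<or> \<^bold>\<not> \<^bold>\<circ> (Var 0) } \<rparr>"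

definition circ_logic_max :: "'c calculus \<Rightarrow> 'c with_circ calculus" where
  "circ_logic_max L = (circ_logic L)
     \<lparr> rules := rules (circ_logic L) \<union>
        { ([\<^bold>\<not> \<^bold>\<not> (Var 0) \<^bold>\<or> Var 1], \<^bold>\<circ> (Var 0) \<^bold>\<or> Var 1) } \<rparr>"

definition propagation_property ::
    "'c with_circ calculus \<Rightarrow>
     ('c with_circ fm \<Rightarrow> 'c with_circ fm \<Rightarrow> 'c with_circ fm) set \<Rightarrow> bool" where
  "propagation_property S ops \<longleftrightarrow>
     (\<forall>c\<in>ops. \<forall>\<phi>\<in>Fm S. \<forall>\<psi>\<in>Fm S. derivable S {} ((\<^bold>\<circ> \<phi> \<^bold>\<and> \<^bold>\<circ> \<psi>) \<^bold>\<rightarrow> \<^bold>\<circ> (c \<phi> \<psi>)))"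

end

theory Submission
  imports Defs
begin

text \<open>
  Over chains the statement is a short case distinction. The axiom
  \<open>\<^bold>\<not> (\<phi> \<^bold>\<and> \<^bold>\<not> \<phi> \<^bold>\<and> \<^bold>\<circ> \<phi>)\<close> says that each element \<open>x\<close> is \<open>0\<close>, or satisfies \<open>\<^bold>\<not> x = 0\<close>,
  or satisfies \<open>\<^bold>\<circ> x = 0\<close>. In the last case there is nothing to prove about \<open>x\<close>. If \<open>x = 0\<close>,
  then \<open>x & y\<close> is \<open>0\<close> and \<open>y \<rightarrow> x\<close> is \<open>\<^bold>\<not> y\<close>, and \<open>\<^bold>\<circ> y \<le> \<^bold>\<circ> \<^bold>\<not> y\<close> follows by the same
  distinction for \<open>y\<close>: either \<open>\<^bold>\<not> y\<close> is \<open>1\<close> or \<open>0\<close>, which are consistent, or \<open>\<^bold>\<circ> y\<close> is \<open>0\<close>. If \<open>\<^bold>\<not> x = 0\<close>, then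
  \<open>x \<le> y \<rightarrow> x\<close> and (Coh) give \<open>\<^bold>\<circ> x \<le> \<^bold>\<circ> (y \<rightarrow> x)\<close>. The meet of two elements of a chain is
  one of them. For \<open>&\<close>, dense elements (those with \<open>\<^bold>\<not> x = 0\<close>) are the only obstacle, and each of the
  three extensions removes it: in \<open>circ_logic_nn\<close> and \<open>circ_logic_min\<close> a dense \<open>x\<close> with
  \<open>\<^bold>\<circ> x \<noteq> 0\<close> equals \<open>1\<close>, so that \<open>x & y = y\<close>; in \<open>circ_logic_max\<close> the product of two dense
  elements is dense, hence consistent.

  This argument about chains is carried out inside the calculus. Say that \<open>\<beta>\<close> is a
  disjunctive consequence of \<open>\<alpha>\<close> if, for every side formula \<open>\<delta>\<close>, provability of
  \<open>\<alpha> \<^bold>\<or> \<delta>\<close> yields provability of \<open>\<beta> \<^bold>\<or> \<delta>\<close>. This relation admits proofs by cases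
  (lemma \<open>dcons_cases\<close>), and (Cong) and (Coh) are formulated with a side
  formula exactly so that they are disjunctive consequences. Hence each case of
  the argument about chains becomes one disjunctive consequence, and the cases themselves come from
  prelinearity (\<open>prelin\<close>) and from the first axiom for \<open>\<^bold>\<circ>\<close> (\<open>circ_trichotomy\<close>).
\<close>

section \<open>The calculus of MTL\<close>

locale mtl_theory =
  fixes T :: "'c fm \<Rightarrow> bool"
  assumes mp: "T \<phi> \<Longrightarrow> T (\<phi> \<^bold>\<rightarrow> \<psi>) \<Longrightarrow> T \<psi>"
    and suffixing: "T ((\<phi> \<^bold>\<rightarrow> \<psi>) \<^bold>\<rightarrow> ((\<psi> \<^bold>\<rightarrow> \<chi>) \<^bold>\<rightarrow> (\<phi> \<^bold>\<rightarrow> \<chi>)))"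
    and amp_left: "T ((\<phi> \<^bold>& \<psi>) \<^bold>\<rightarrow> \<phi>)"
    and amp_comm: "T ((\<phi> \<^bold>& \<psi>) \<^bold>\<rightarrow> (\<psi> \<^bold>& \<phi>))"
    and and_left: "T ((\<phi> \<^bold>\<and> \<psi>) \<^bold>\<rightarrow> \<phi>)"
    and and_comm: "T ((\<phi> \<^bold>\<and> \<psi>) \<^bold>\<rightarrow> (\<psi> \<^bold>\<and> \<phi>))"
    and amp_imp_and: "T ((\<phi> \<^bold>& (\<phi> \<^bold>\<rightarrow> \<psi>)) \<^bold>\<rightarrow> (\<phi> \<^bold>\<and> \<psi>))"
    and uncurry_ax: "T ((\<phi> \<^bold>\<rightarrow> (\<psi> \<^bold>\<rightarrow> \<chi>)) \<^bold>\<rightarrow> ((\<phi> \<^bold>& \<psi>) \<^bold>\<rightarrow> \<chi>))"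
    and curry_ax: "T (((\<phi> \<^bold>& \<psi>) \<^bold>\<rightarrow> \<chi>) \<^bold>\<rightarrow> (\<phi> \<^bold>\<rightarrow> (\<psi> \<^bold>\<rightarrow> \<chi>)))"
    and prelin_ax: "T (((\<phi> \<^bold>\<rightarrow> \<psi>) \<^bold>\<rightarrow> \<chi>) \<^bold>\<rightarrow> (((\<psi> \<^bold>\<rightarrow> \<phi>) \<^bold>\<rightarrow> \<chi>) \<^bold>\<rightarrow> \<chi>))"
    and ex_falso: "T (\<^bold>0 \<^bold>\<rightarrow> \<phi>)"
begin

abbreviation below (infix \<open>\<sqsubseteq>\<close> 45) where "\<phi> \<sqsubseteq> \<psi> \<equiv> T (\<phi> \<^bold>\<rightarrow> \<psi>)"

lemma below_trans [trans]: "\<phi> \<sqsubseteq> \<psi> \<Longrightarrow> \<psi> \<sqsubseteq> \<chi> \<Longrightarrow> \<phi> \<sqsubseteq> \<chi>"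
  using mp suffixing by blast

lemma residuation: "\<phi> \<^bold>& \<psi> \<sqsubseteq> \<chi> \<longleftrightarrow> \<phi> \<sqsubseteq> \<psi> \<^bold>\<rightarrow> \<chi>"
  using mp uncurry_ax curry_ax by blast

lemma amp_right: "\<phi> \<^bold>& \<psi> \<sqsubseteq> \<psi>"
  using below_trans amp_comm amp_left by blast

lemma weakening: "\<phi> \<sqsubseteq> \<psi> \<^bold>\<rightarrow> \<phi>"
  using residuation amp_left by blast

lemma below_of_theorem: "T \<psi> \<Longrightarrow> \<phi> \<sqsubseteq> \<psi>"
  using mp weakening by blast

lemma below_refl: "\<phi> \<sqsubseteq> \<phi>"
proof -
  have "(\<^bold>0 \<^bold>\<rightarrow> \<phi>) \<sqsubseteq> \<phi> \<^bold>\<rightarrow> \<phi>" using residuation amp_right by blast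
  then show ?thesis using mp ex_falso by blast
qed

lemma exchange: "\<phi> \<sqsubseteq> \<psi> \<^bold>\<rightarrow> \<chi> \<Longrightarrow> \<psi> \<sqsubseteq> \<phi> \<^bold>\<rightarrow> \<chi>"
  using residuation below_trans amp_comm by blast

lemma imp_antimono: "\<phi> \<sqsubseteq> \<psi> \<Longrightarrow> (\<psi> \<^bold>\<rightarrow> \<chi>) \<sqsubseteq> \<phi> \<^bold>\<rightarrow> \<chi>"
  using mp suffixing by blast

lemma imp_mono: "\<phi> \<sqsubseteq> \<psi> \<Longrightarrow> (\<chi> \<^bold>\<rightarrow> \<phi>) \<sqsubseteq> \<chi> \<^bold>\<rightarrow> \<psi>"
  using mp exchange[OF suffixing] by blast

lemma detach: "T \<phi> \<Longrightarrow> (\<phi> \<^bold>\<rightarrow> \<psi>) \<sqsubseteq> \<psi>"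
  using mp exchange[OF below_refl] by blast

lemma prelinearity: "(\<phi> \<^bold>\<rightarrow> \<psi>) \<sqsubseteq> \<chi> \<Longrightarrow> (\<psi> \<^bold>\<rightarrow> \<phi>) \<sqsubseteq> \<chi> \<Longrightarrow> T \<chi>"
  using mp prelin_ax by blast

lemma and_right: "\<phi> \<^bold>\<and> \<psi> \<sqsubseteq> \<psi>"
  using below_trans and_comm and_left by blast

lemma imp_and: "(\<phi> \<^bold>\<rightarrow> \<psi>) \<sqsubseteq> \<phi> \<^bold>\<rightarrow> (\<phi> \<^bold>\<and> \<psi>)"
  using exchange residuation amp_imp_and by blast

lemma modus_ponens_below: "\<phi> \<sqsubseteq> (\<phi> \<^bold>\<rightarrow> \<psi>) \<^bold>\<rightarrow> \<psi>"
  using exchange below_refl by blast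

text \<open>
  No axiom says that \<open>\<phi> \<^bold>\<and> \<psi>\<close> is the greatest lower bound; this comes from prelinearity. Under
  \<open>\<phi> \<^bold>\<rightarrow> \<psi>\<close> the formula \<open>\<phi>\<close> itself is below \<open>\<phi> \<^bold>\<and> \<psi>\<close> (lemma \<open>imp_and\<close>), and symmetrically.
\<close>
lemma below_and: assumes "\<chi> \<sqsubseteq> \<phi>" "\<chi> \<sqsubseteq> \<psi>" shows "\<chi> \<sqsubseteq> \<phi> \<^bold>\<and> \<psi>"
proof (rule prelinearity)
  show "(\<phi> \<^bold>\<rightarrow> \<psi>) \<sqsubseteq> \<chi> \<^bold>\<rightarrow> (\<phi> \<^bold>\<and> \<psi>)"
    using below_trans[OF imp_and imp_antimono[OF assms(1)]] .
  show "(\<psi> \<^bold>\<rightarrow> \<phi>) \<sqsubseteq> \<chi> \<^bold>\<rightarrow> (\<phi> \<^bold>\<and> \<psi>)"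
    using below_trans[OF below_trans[OF imp_and imp_antimono[OF assms(2)]] imp_mono[OF and_comm]] .
qed

lemma or_left: "\<phi> \<sqsubseteq> \<phi> \<^bold>\<or> \<psi>"
  unfolding Or_def by (intro below_and modus_ponens_below weakening)

lemma or_right: "\<psi> \<sqsubseteq> \<phi> \<^bold>\<or> \<psi>"
  unfolding Or_def by (intro below_and modus_ponens_below weakening)

lemma or_below: assumes "\<phi> \<sqsubseteq> \<chi>" "\<psi> \<sqsubseteq> \<chi>" shows "\<phi> \<^bold>\<or> \<psi> \<sqsubseteq> \<chi>"
proof (rule prelinearity)
  have "(\<phi> \<^bold>\<rightarrow> \<psi>) \<sqsubseteq> (\<phi> \<^bold>\<or> \<psi>) \<^bold>\<rightarrow> \<psi>"
    unfolding Or_def using exchange[OF and_left] .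
  then show "(\<phi> \<^bold>\<rightarrow> \<psi>) \<sqsubseteq> (\<phi> \<^bold>\<or> \<psi>) \<^bold>\<rightarrow> \<chi>"
    using below_trans imp_mono[OF assms(2)] by blast
  have "(\<psi> \<^bold>\<rightarrow> \<phi>) \<sqsubseteq> (\<phi> \<^bold>\<or> \<psi>) \<^bold>\<rightarrow> \<phi>"
    unfolding Or_def using exchange[OF and_right] .
  then show "(\<psi> \<^bold>\<rightarrow> \<phi>) \<sqsubseteq> (\<phi> \<^bold>\<or> \<psi>) \<^bold>\<rightarrow> \<chi>"
    using below_trans imp_mono[OF assms(1)] by blast
qed

lemma or_mono: "\<phi> \<sqsubseteq> \<phi>' \<Longrightarrow> \<psi> \<sqsubseteq> \<psi>' \<Longrightarrow> \<phi> \<^bold>\<or> \<psi> \<sqsubseteq> \<phi>' \<^bold>\<or> \<psi>'"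
  by (meson or_below or_left or_right below_trans)

lemma prelin: "T ((\<phi> \<^bold>\<rightarrow> \<psi>) \<^bold>\<or> (\<psi> \<^bold>\<rightarrow> \<phi>))"
  by (rule prelinearity[OF or_left or_right])

lemma iffD: "(\<phi> \<^bold>\<leftrightarrow> \<psi>) \<sqsubseteq> \<psi> \<^bold>\<rightarrow> \<phi>"
  unfolding Iff_def by (rule and_right)

lemma below_iff: "\<chi> \<sqsubseteq> \<phi> \<^bold>\<rightarrow> \<psi> \<Longrightarrow> \<chi> \<sqsubseteq> \<psi> \<^bold>\<rightarrow> \<phi> \<Longrightarrow> \<chi> \<sqsubseteq> \<phi> \<^bold>\<leftrightarrow> \<psi>"
  unfolding Iff_def by (rule below_and)

lemma de_morgan: "\<^bold>\<not> (\<phi> \<^bold>\<and> \<psi>) \<sqsubseteq> \<^bold>\<not> \<phi> \<^bold>\<or> \<^bold>\<not> \<psi>"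
proof (rule prelinearity)
  have *: "(\<alpha> \<^bold>\<rightarrow> \<beta>) \<sqsubseteq> \<^bold>\<not> (\<alpha> \<^bold>\<and> \<beta>) \<^bold>\<rightarrow> \<^bold>\<not> \<alpha>" for \<alpha> \<beta>
    unfolding Neg_def using below_trans[OF imp_and suffixing] .
  show "(\<phi> \<^bold>\<rightarrow> \<psi>) \<sqsubseteq> \<^bold>\<not> (\<phi> \<^bold>\<and> \<psi>) \<^bold>\<rightarrow> (\<^bold>\<not> \<phi> \<^bold>\<or> \<^bold>\<not> \<psi>)"
    using below_trans[OF * imp_mono[OF or_left]] .
  have "\<^bold>\<not> (\<phi> \<^bold>\<and> \<psi>) \<sqsubseteq> \<^bold>\<not> (\<psi> \<^bold>\<and> \<phi>)"
    unfolding Neg_def by (rule imp_antimono[OF and_comm])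
  then show "(\<psi> \<^bold>\<rightarrow> \<phi>) \<sqsubseteq> \<^bold>\<not> (\<phi> \<^bold>\<and> \<psi>) \<^bold>\<rightarrow> (\<^bold>\<not> \<phi> \<^bold>\<or> \<^bold>\<not> \<psi>)"
    using below_trans[OF below_trans[OF * imp_mono[OF or_right]] imp_antimono] by blast
qed

lemma neg_below_imp: "\<^bold>\<not> \<phi> \<sqsubseteq> \<phi> \<^bold>\<rightarrow> \<psi>"
  unfolding Neg_def by (rule imp_mono[OF ex_falso])

lemma below_neg_neg: "\<phi> \<sqsubseteq> \<^bold>\<not> \<^bold>\<not> \<phi>"
  unfolding Neg_def by (rule modus_ponens_below)

lemma neg_neg_mono: "\<phi> \<sqsubseteq> \<psi> \<Longrightarrow> \<^bold>\<not> \<^bold>\<not> \<phi> \<sqsubseteq> \<^bold>\<not> \<^bold>\<not> \<psi>"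
  unfolding Neg_def by (intro imp_antimono)

text \<open>
  With \<open>\<nu> = \<^bold>\<not> (\<phi> \<^bold>& \<psi>)\<close>, two contrapositions turn \<open>\<phi> \<^bold>& \<nu> \<sqsubseteq> \<^bold>\<not> \<psi>\<close> into
  \<open>\<^bold>\<not> \<^bold>\<not> \<psi> \<^bold>& \<nu> \<sqsubseteq> \<^bold>\<not> \<phi>\<close> and then into \<open>\<^bold>\<not> \<^bold>\<not> \<phi> \<sqsubseteq> \<^bold>\<not> (\<^bold>\<not> \<^bold>\<not> \<psi> \<^bold>& \<nu>)\<close>.
\<close>
lemma neg_neg_amp: "\<^bold>\<not> \<^bold>\<not> \<phi> \<^bold>& \<^bold>\<not> \<^bold>\<not> \<psi> \<sqsubseteq> \<^bold>\<not> \<^bold>\<not> (\<phi> \<^bold>& \<psi>)"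
proof -
  define \<nu> where "\<nu> = \<^bold>\<not> (\<phi> \<^bold>& \<psi>)"
  have "\<nu> \<sqsubseteq> \<phi> \<^bold>\<rightarrow> \<^bold>\<not> \<psi>" unfolding \<nu>_def Neg_def by (rule curry_ax)
  also have "(\<phi> \<^bold>\<rightarrow> \<^bold>\<not> \<psi>) \<sqsubseteq> \<^bold>\<not> \<^bold>\<not> \<psi> \<^bold>\<rightarrow> \<^bold>\<not> \<phi>" unfolding Neg_def by (rule suffixing)
  finally have "\<^bold>\<not> \<^bold>\<not> \<psi> \<^bold>& \<nu> \<sqsubseteq> \<^bold>\<not> \<phi>" using residuation exchange by blast
  then have "\<^bold>\<not> \<^bold>\<not> \<phi> \<sqsubseteq> (\<^bold>\<not> \<^bold>\<not> \<psi> \<^bold>& \<nu>) \<^bold>\<rightarrow> \<^bold>0" unfolding Neg_def by (rule imp_antimono)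
  also have "((\<^bold>\<not> \<^bold>\<not> \<psi> \<^bold>& \<nu>) \<^bold>\<rightarrow> \<^bold>0) \<sqsubseteq> \<^bold>\<not> \<^bold>\<not> \<psi> \<^bold>\<rightarrow> \<^bold>\<not> \<nu>"
    unfolding Neg_def[of \<nu>] by (rule curry_ax)
  finally show ?thesis unfolding \<nu>_def residuation .
qed


section \<open>Disjunctive consequence\<close>

text \<open>
  Rules such as (Cong) do not internalize as implications: over a chain they only say
  that one value is \<open>1\<close> whenever another is. With a side formula, this form of consequence still
  supports case distinctions, because over a chain a disjunction has value \<open>1\<close> only if one of its
  members has.
\<close>
definition dcons (infix \<open>\<tturnstile>\<close> 45) where
  "\<alpha> \<tturnstile> \<beta> \<longleftrightarrow> (\<forall>\<delta>. T (\<alpha> \<^bold>\<or> \<delta>) \<longrightarrow> T (\<beta> \<^bold>\<or> \<delta>))"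

lemma dcons_below: "\<alpha> \<sqsubseteq> \<beta> \<Longrightarrow> \<alpha> \<tturnstile> \<beta>"
  unfolding dcons_def using mp or_mono below_refl by blast

lemma dcons_trans [trans]: "\<alpha> \<tturnstile> \<beta> \<Longrightarrow> \<beta> \<tturnstile> \<gamma> \<Longrightarrow> \<alpha> \<tturnstile> \<gamma>"
  unfolding dcons_def by blast

lemma below_dcons_trans [trans]: "\<alpha> \<sqsubseteq> \<beta> \<Longrightarrow> \<beta> \<tturnstile> \<gamma> \<Longrightarrow> \<alpha> \<tturnstile> \<gamma>"
  using dcons_below dcons_trans by blast

lemma dcons_below_trans [trans]: "\<alpha> \<tturnstile> \<beta> \<Longrightarrow> \<beta> \<sqsubseteq> \<gamma> \<Longrightarrow> \<alpha> \<tturnstile> \<gamma>"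
  using dcons_below dcons_trans by blast

lemma or_swap: "T (\<alpha> \<^bold>\<or> \<beta>) \<Longrightarrow> T (\<beta> \<^bold>\<or> \<alpha>)"
  using mp or_below or_left or_right by blast

lemma dcons_or_right: "\<beta> \<tturnstile> \<gamma> \<Longrightarrow> T (\<delta> \<^bold>\<or> \<beta>) \<Longrightarrow> T (\<delta> \<^bold>\<or> \<gamma>)"
  unfolding dcons_def using or_swap by blast

text \<open>
  The side formula of the first case is the second case, and the side formula of the
  second case is the conclusion.
\<close>
lemma dcons_cases: assumes "T (\<alpha> \<^bold>\<or> \<beta>)" "\<alpha> \<tturnstile> \<gamma>" "\<beta> \<tturnstile> \<gamma>" shows "T \<gamma>"
proof -
  have "T (\<gamma> \<^bold>\<or> \<beta>)" using assms(1,2) unfolding dcons_def by blast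
  then have "T (\<gamma> \<^bold>\<or> \<gamma>)" using assms(3) dcons_or_right by blast
  then show ?thesis using mp or_below below_refl by blast
qed

lemma dcons_or: assumes "\<alpha> \<tturnstile> \<gamma>" "\<beta> \<tturnstile> \<gamma>" shows "\<alpha> \<^bold>\<or> \<beta> \<tturnstile> \<gamma>"
  unfolding dcons_def
proof (intro allI impI)
  fix \<delta>
  have assoc: "(\<alpha> \<^bold>\<or> \<beta>) \<^bold>\<or> \<delta> \<sqsubseteq> \<alpha> \<^bold>\<or> (\<beta> \<^bold>\<or> \<delta>)"
    by (meson or_below or_left or_right below_trans)
  have weaken: "\<xi> \<tturnstile> \<gamma> \<Longrightarrow> \<xi> \<tturnstile> \<gamma> \<^bold>\<or> \<delta>" for \<xi>
    using dcons_below_trans or_left by blast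
  assume "T ((\<alpha> \<^bold>\<or> \<beta>) \<^bold>\<or> \<delta>)"
  then have "T (\<alpha> \<^bold>\<or> (\<beta> \<^bold>\<or> \<delta>))" using mp assoc by blast
  then have "T ((\<gamma> \<^bold>\<or> \<delta>) \<^bold>\<or> (\<beta> \<^bold>\<or> \<delta>))" using weaken[OF assms(1)] unfolding dcons_def by blast
  moreover have "(\<gamma> \<^bold>\<or> \<delta>) \<^bold>\<or> (\<beta> \<^bold>\<or> \<delta>) \<sqsubseteq> \<beta> \<^bold>\<or> (\<gamma> \<^bold>\<or> \<delta>)"
    by (meson or_below or_left or_right below_trans)
  ultimately have "T (\<beta> \<^bold>\<or> (\<gamma> \<^bold>\<or> \<delta>))" using mp by blast
  then show "T (\<gamma> \<^bold>\<or> \<delta>)"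
    by (rule dcons_cases) (intro weaken assms(2) dcons_below below_refl)+
qed

text \<open>
  Two facts that hold up to the same side formula combine even to their fusion. The meet would be too large for \<open>neg_neg_amp\<close>, which fails with \<open>\<^bold>\<and>\<close> in
  place of \<open>\<^bold>&\<close> on its left-hand side.
\<close>
lemma or_amp: assumes "T (\<alpha> \<^bold>\<or> \<delta>)" "T (\<beta> \<^bold>\<or> \<delta>)" shows "T ((\<alpha> \<^bold>& \<beta>) \<^bold>\<or> \<delta>)"
proof -
  let ?\<gamma> = "(\<alpha> \<^bold>& \<beta>) \<^bold>\<or> \<delta>"
  have "\<alpha> \<sqsubseteq> \<beta> \<^bold>\<rightarrow> ?\<gamma>" using residuation or_left by blast
  moreover have "\<delta> \<sqsubseteq> \<beta> \<^bold>\<rightarrow> ?\<gamma>" using below_trans[OF or_right weakening] .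
  ultimately have "\<beta> \<sqsubseteq> ?\<gamma>" using mp[OF assms(1)] or_below by blast
  then show ?thesis using mp[OF assms(2)] or_below or_right by blast
qed

end


section \<open>The consistency operator\<close>

locale consistency_theory = mtl_theory T for T :: "'c with_circ fm \<Rightarrow> bool" +
  assumes circ_ax: "T (\<^bold>\<not> (\<phi> \<^bold>\<and> \<^bold>\<not> \<phi> \<^bold>\<and> \<^bold>\<circ> \<phi>))"
    and circ_one: "T (\<^bold>\<circ> \<^bold>1)"
    and circ_zero: "T (\<^bold>\<circ> \<^bold>0)"
    and cong_rule: "T ((\<phi> \<^bold>\<leftrightarrow> \<psi>) \<^bold>\<or> \<delta>) \<Longrightarrow> T ((\<^bold>\<circ> \<phi> \<^bold>\<leftrightarrow> \<^bold>\<circ> \<psi>) \<^bold>\<or> \<delta>)"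
    and coh_rule: "T ((\<^bold>\<not> \<^bold>\<not> \<phi> \<^bold>\<and> (\<phi> \<^bold>\<rightarrow> \<psi>)) \<^bold>\<or> \<delta>) \<Longrightarrow> T ((\<^bold>\<circ> \<phi> \<^bold>\<rightarrow> \<^bold>\<circ> \<psi>) \<^bold>\<or> \<delta>)"
begin

lemma cong: "(\<phi> \<^bold>\<leftrightarrow> \<psi>) \<tturnstile> (\<^bold>\<circ> \<phi> \<^bold>\<leftrightarrow> \<^bold>\<circ> \<psi>)"
  unfolding dcons_def using cong_rule by blast

lemma coh: "(\<^bold>\<not> \<^bold>\<not> \<phi> \<^bold>\<and> (\<phi> \<^bold>\<rightarrow> \<psi>)) \<tturnstile> (\<^bold>\<circ> \<phi> \<^bold>\<rightarrow> \<^bold>\<circ> \<psi>)"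
  unfolding dcons_def using coh_rule by blast

lemma circ_trichotomy: "T (\<^bold>\<not> \<phi> \<^bold>\<or> \<^bold>\<not> \<^bold>\<not> \<phi> \<^bold>\<or> \<^bold>\<not> \<^bold>\<circ> \<phi>)"
  using mp[OF mp[OF circ_ax de_morgan] or_mono[OF below_refl de_morgan]] .

lemma dcons_circ_imp:
  assumes "\<alpha> \<sqsubseteq> \<phi> \<^bold>\<rightarrow> \<psi>" "\<alpha> \<sqsubseteq> \<psi> \<^bold>\<rightarrow> \<phi>"
  shows "\<alpha> \<tturnstile> (\<^bold>\<circ> \<psi> \<^bold>\<rightarrow> \<^bold>\<circ> \<phi>)"
proof -
  have "\<alpha> \<sqsubseteq> \<phi> \<^bold>\<leftrightarrow> \<psi>" using assms by (rule below_iff)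
  also note cong
  also note iffD
  finally show ?thesis .
qed

lemma dcons_circ_one: assumes "\<alpha> \<sqsubseteq> \<phi>" shows "\<alpha> \<tturnstile> \<^bold>\<circ> \<phi>"
proof -
  have "T \<^bold>1" unfolding One_def Neg_def by (rule below_refl)
  then have "\<alpha> \<tturnstile> (\<^bold>\<circ> \<^bold>1 \<^bold>\<rightarrow> \<^bold>\<circ> \<phi>)"
    using dcons_circ_imp below_of_theorem below_trans[OF assms weakening] by blast
  also have "(\<^bold>\<circ> \<^bold>1 \<^bold>\<rightarrow> \<^bold>\<circ> \<phi>) \<sqsubseteq> \<^bold>\<circ> \<phi>" by (rule detach[OF circ_one])
  finally show ?thesis .
qed

lemma dcons_circ_zero: assumes "\<alpha> \<sqsubseteq> \<^bold>\<not> \<phi>" shows "\<alpha> \<tturnstile> \<^bold>\<circ> \<phi>"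
proof -
  have "\<alpha> \<tturnstile> (\<^bold>\<circ> \<^bold>0 \<^bold>\<rightarrow> \<^bold>\<circ> \<phi>)"
    using dcons_circ_imp[OF assms[unfolded Neg_def]] below_of_theorem ex_falso by blast
  also have "(\<^bold>\<circ> \<^bold>0 \<^bold>\<rightarrow> \<^bold>\<circ> \<phi>) \<sqsubseteq> \<^bold>\<circ> \<phi>" by (rule detach[OF circ_zero])
  finally show ?thesis .
qed

text \<open>
  Needed for the implications \<open>\<phi> \<^bold>\<rightarrow> \<psi>\<close> with \<open>\<psi>\<close> equivalent to \<open>\<^bold>0\<close>: in the first two cases of
  \<open>circ_trichotomy\<close>, \<open>\<^bold>\<not> \<phi>\<close> is equivalent to \<open>\<^bold>1\<close> or to \<open>\<^bold>0\<close>.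
\<close>
lemma circ_neg: "\<^bold>\<circ> \<phi> \<sqsubseteq> \<^bold>\<circ> (\<^bold>\<not> \<phi>)"
proof (rule dcons_cases[OF circ_trichotomy dcons_below_trans[OF dcons_circ_one weakening]])
  show "\<^bold>\<not> \<phi> \<sqsubseteq> \<^bold>\<not> \<phi>" by (rule below_refl)
  show "\<^bold>\<not> \<^bold>\<not> \<phi> \<^bold>\<or> \<^bold>\<not> \<^bold>\<circ> \<phi> \<tturnstile> (\<^bold>\<circ> \<phi> \<^bold>\<rightarrow> \<^bold>\<circ> (\<^bold>\<not> \<phi>))"
    using dcons_or dcons_below_trans[OF dcons_circ_zero[OF below_refl] weakening]
      dcons_below[OF neg_below_imp] by blast
qed

lemma and_imp_left: "(\<alpha> \<^bold>\<rightarrow> \<gamma>) \<sqsubseteq> (\<alpha> \<^bold>\<and> \<beta>) \<^bold>\<rightarrow> \<gamma>"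
  by (rule imp_antimono[OF and_left])

lemma and_imp_right: "(\<beta> \<^bold>\<rightarrow> \<gamma>) \<sqsubseteq> (\<alpha> \<^bold>\<and> \<beta>) \<^bold>\<rightarrow> \<gamma>"
  by (rule imp_antimono[OF and_right])

text \<open>By prelinearity, \<open>\<phi> \<^bold>\<and> \<psi>\<close> may be identified with \<open>\<phi>\<close> or with \<open>\<psi>\<close>.\<close>
theorem propagation_and: "\<^bold>\<circ> \<phi> \<^bold>\<and> \<^bold>\<circ> \<psi> \<sqsubseteq> \<^bold>\<circ> (\<phi> \<^bold>\<and> \<psi>)"
proof (rule dcons_cases[OF prelin])
  have "(\<phi> \<^bold>\<rightarrow> \<psi>) \<tturnstile> (\<^bold>\<circ> \<phi> \<^bold>\<rightarrow> \<^bold>\<circ> (\<phi> \<^bold>\<and> \<psi>))"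
    by (intro dcons_circ_imp imp_and below_of_theorem and_left)
  then show "(\<phi> \<^bold>\<rightarrow> \<psi>) \<tturnstile> ((\<^bold>\<circ> \<phi> \<^bold>\<and> \<^bold>\<circ> \<psi>) \<^bold>\<rightarrow> \<^bold>\<circ> (\<phi> \<^bold>\<and> \<psi>))"
    using dcons_below_trans and_imp_left by blast
  have "(\<psi> \<^bold>\<rightarrow> \<phi>) \<tturnstile> (\<^bold>\<circ> \<psi> \<^bold>\<rightarrow> \<^bold>\<circ> (\<phi> \<^bold>\<and> \<psi>))"
    by (intro dcons_circ_imp below_trans[OF imp_and imp_mono[OF and_comm]]
        below_of_theorem and_right)
  then show "(\<psi> \<^bold>\<rightarrow> \<phi>) \<tturnstile> ((\<^bold>\<circ> \<phi> \<^bold>\<and> \<^bold>\<circ> \<psi>) \<^bold>\<rightarrow> \<^bold>\<circ> (\<phi> \<^bold>\<and> \<psi>))"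
    using dcons_below_trans and_imp_right by blast
qed

text \<open>
  If \<open>\<psi>\<close> is \<open>\<^bold>0\<close>, then \<open>\<phi> \<^bold>\<rightarrow> \<psi>\<close> is \<open>\<^bold>\<not> \<phi>\<close> and \<open>\<^bold>\<circ> \<phi>\<close> is the premise that matters; if \<open>\<psi>\<close> is
  dense, (Coh) applies to \<open>\<psi> \<sqsubseteq> \<phi> \<^bold>\<rightarrow> \<psi>\<close> and \<open>\<^bold>\<circ> \<psi>\<close> matters.
\<close>
theorem propagation_imp: "\<^bold>\<circ> \<phi> \<^bold>\<and> \<^bold>\<circ> \<psi> \<sqsubseteq> \<^bold>\<circ> (\<phi> \<^bold>\<rightarrow> \<psi>)"
proof -
  let ?G = "(\<^bold>\<circ> \<phi> \<^bold>\<and> \<^bold>\<circ> \<psi>) \<^bold>\<rightarrow> \<^bold>\<circ> (\<phi> \<^bold>\<rightarrow> \<psi>)"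
  have zero: "\<^bold>\<not> \<psi> \<tturnstile> ?G"
  proof -
    have "\<^bold>\<not> \<psi> \<sqsubseteq> (\<phi> \<^bold>\<rightarrow> \<psi>) \<^bold>\<rightarrow> \<^bold>\<not> \<phi>"
      unfolding Neg_def by (rule exchange[OF suffixing])
    moreover have "\<^bold>\<not> \<psi> \<sqsubseteq> \<^bold>\<not> \<phi> \<^bold>\<rightarrow> (\<phi> \<^bold>\<rightarrow> \<psi>)"
      by (intro below_of_theorem neg_below_imp)
    ultimately have "\<^bold>\<not> \<psi> \<tturnstile> (\<^bold>\<circ> (\<^bold>\<not> \<phi>) \<^bold>\<rightarrow> \<^bold>\<circ> (\<phi> \<^bold>\<rightarrow> \<psi>))"
      by (rule dcons_circ_imp)
    also have "(\<^bold>\<circ> (\<^bold>\<not> \<phi>) \<^bold>\<rightarrow> \<^bold>\<circ> (\<phi> \<^bold>\<rightarrow> \<psi>)) \<sqsubseteq> \<^bold>\<circ> \<phi> \<^bold>\<rightarrow> \<^bold>\<circ> (\<phi> \<^bold>\<rightarrow> \<psi>)"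
      by (rule imp_antimono[OF circ_neg])
    also note and_imp_left
    finally show ?thesis .
  qed
  have dense: "\<^bold>\<not> \<^bold>\<not> \<psi> \<tturnstile> ?G"
  proof -
    have "\<^bold>\<not> \<^bold>\<not> \<psi> \<sqsubseteq> \<^bold>\<not> \<^bold>\<not> \<psi> \<^bold>\<and> (\<psi> \<^bold>\<rightarrow> (\<phi> \<^bold>\<rightarrow> \<psi>))"
      by (intro below_and below_refl below_of_theorem weakening)
    also note coh
    also note and_imp_right
    finally show ?thesis .
  qed
  have "\<^bold>\<not> \<^bold>\<circ> \<psi> \<tturnstile> ?G"
    by (rule dcons_below[OF below_trans[OF neg_below_imp and_imp_right]])
  then show ?thesis
    using dcons_cases[OF circ_trichotomy zero dcons_or[OF dense]] by blast
qed

lemma dcons_amp_zero_left: "\<^bold>\<not> \<phi> \<tturnstile> ((\<^bold>\<circ> \<phi> \<^bold>\<and> \<^bold>\<circ> \<psi>) \<^bold>\<rightarrow> \<^bold>\<circ> (\<phi> \<^bold>& \<psi>))"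
proof -
  have "\<^bold>\<not> \<phi> \<tturnstile> \<^bold>\<circ> (\<phi> \<^bold>& \<psi>)"
    unfolding Neg_def by (rule dcons_circ_zero[unfolded Neg_def, OF imp_antimono[OF amp_left]])
  then show ?thesis using dcons_below_trans weakening by blast
qed

lemma dcons_amp_zero_right: "\<^bold>\<not> \<psi> \<tturnstile> ((\<^bold>\<circ> \<phi> \<^bold>\<and> \<^bold>\<circ> \<psi>) \<^bold>\<rightarrow> \<^bold>\<circ> (\<phi> \<^bold>& \<psi>))"
proof -
  have "\<^bold>\<not> \<psi> \<tturnstile> \<^bold>\<circ> (\<phi> \<^bold>& \<psi>)"
    unfolding Neg_def by (rule dcons_circ_zero[unfolded Neg_def, OF imp_antimono[OF amp_right]])
  then show ?thesis using dcons_below_trans weakening by blast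
qed

text \<open>
  The hypothesis sharpens \<open>circ_trichotomy\<close>: over a chain, \<open>\<phi>\<close> is \<open>\<^bold>1\<close> or \<open>\<^bold>0\<close>, or \<open>\<^bold>\<circ> \<phi>\<close> is \<open>\<^bold>0\<close>.
  In the first case \<open>\<phi> \<^bold>& \<psi>\<close> is \<open>\<psi>\<close>, in the second it is \<open>\<^bold>0\<close>.
\<close>
theorem propagation_amp_of_sharp_trichotomy:
  assumes "T (\<phi> \<^bold>\<or> \<^bold>\<not> \<phi> \<^bold>\<or> \<^bold>\<not> \<^bold>\<circ> \<phi>)"
  shows "\<^bold>\<circ> \<phi> \<^bold>\<and> \<^bold>\<circ> \<psi> \<sqsubseteq> \<^bold>\<circ> (\<phi> \<^bold>& \<psi>)"
proof (rule dcons_cases[OF assms _ dcons_or[OF dcons_amp_zero_left]])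
  have "\<phi> \<sqsubseteq> \<psi> \<^bold>\<rightarrow> (\<phi> \<^bold>& \<psi>)" using residuation below_refl by blast
  then have "\<phi> \<tturnstile> (\<^bold>\<circ> \<psi> \<^bold>\<rightarrow> \<^bold>\<circ> (\<phi> \<^bold>& \<psi>))"
    using dcons_circ_imp below_of_theorem amp_right by blast
  also note and_imp_right
  finally show "\<phi> \<tturnstile> ((\<^bold>\<circ> \<phi> \<^bold>\<and> \<^bold>\<circ> \<psi>) \<^bold>\<rightarrow> \<^bold>\<circ> (\<phi> \<^bold>& \<psi>))" .
  show "\<^bold>\<not> \<^bold>\<circ> \<phi> \<tturnstile> ((\<^bold>\<circ> \<phi> \<^bold>\<and> \<^bold>\<circ> \<psi>) \<^bold>\<rightarrow> \<^bold>\<circ> (\<phi> \<^bold>& \<psi>))"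
    by (rule dcons_below[OF below_trans[OF neg_below_imp and_imp_left]])
qed

text \<open>
  The rule for double negation carries no side formula, but \<open>\<^bold>\<not> \<^bold>\<not> \<phi> \<^bold>\<or> \<delta>\<close> implies \<open>\<^bold>\<not> \<^bold>\<not> (\<phi> \<^bold>\<or> \<delta>)\<close>,
  so that the side formula can be moved under the double negation.
\<close>
lemma sharp_trichotomy_of_double_negation:
  assumes nn: "\<And>\<alpha>. T (\<^bold>\<not> \<^bold>\<not> \<alpha>) \<Longrightarrow> T \<alpha>"
  shows "T (\<phi> \<^bold>\<or> \<^bold>\<not> \<phi> \<^bold>\<or> \<^bold>\<not> \<^bold>\<circ> \<phi>)"
proof (rule nn, rule mp[OF circ_trichotomy])
  let ?\<delta> = "\<phi> \<^bold>\<or> \<^bold>\<not> \<phi> \<^bold>\<or> \<^bold>\<not> \<^bold>\<circ> \<phi>"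
  have "\<^bold>\<not> \<^bold>\<not> \<phi> \<sqsubseteq> \<^bold>\<not> \<^bold>\<not> ?\<delta>"
    by (rule neg_neg_mono[OF or_left])
  moreover have "\<^bold>\<not> \<phi> \<sqsubseteq> \<^bold>\<not> \<^bold>\<not> ?\<delta>" "\<^bold>\<not> \<^bold>\<circ> \<phi> \<sqsubseteq> \<^bold>\<not> \<^bold>\<not> ?\<delta>"
    by (meson below_neg_neg or_left or_right below_trans)+
  ultimately show "\<^bold>\<not> \<phi> \<^bold>\<or> \<^bold>\<not> \<^bold>\<not> \<phi> \<^bold>\<or> \<^bold>\<not> \<^bold>\<circ> \<phi> \<sqsubseteq> \<^bold>\<not> \<^bold>\<not> ?\<delta>"
    by (intro or_below)
qed

text \<open>
  Up to the conclusion as a side formula, \<open>circ_trichotomy\<close> leaves only the case in which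
  \<open>\<phi>\<close> and \<open>\<psi>\<close> are both dense. Then \<open>\<phi> \<^bold>& \<psi>\<close> is dense, and the hypothesis makes it consistent.
\<close>
theorem propagation_amp_of_dense_circ:
  assumes dense: "\<And>\<alpha> \<delta>. T (\<^bold>\<not> \<^bold>\<not> \<alpha> \<^bold>\<or> \<delta>) \<Longrightarrow> T (\<^bold>\<circ> \<alpha> \<^bold>\<or> \<delta>)"
  shows "\<^bold>\<circ> \<phi> \<^bold>\<and> \<^bold>\<circ> \<psi> \<sqsubseteq> \<^bold>\<circ> (\<phi> \<^bold>& \<psi>)"
proof -
  let ?G = "(\<^bold>\<circ> \<phi> \<^bold>\<and> \<^bold>\<circ> \<psi>) \<^bold>\<rightarrow> \<^bold>\<circ> (\<phi> \<^bold>& \<psi>)"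
  have reduce: "T (\<^bold>\<not> \<^bold>\<not> \<alpha> \<^bold>\<or> ?G)" if "\<^bold>\<not> \<alpha> \<tturnstile> ?G" "\<^bold>\<not> \<^bold>\<circ> \<alpha> \<sqsubseteq> ?G" for \<alpha>
  proof (rule dcons_cases[OF circ_trichotomy _ dcons_or])
    show "\<^bold>\<not> \<alpha> \<tturnstile> (\<^bold>\<not> \<^bold>\<not> \<alpha> \<^bold>\<or> ?G)" using dcons_below_trans[OF that(1) or_right] .
    show "\<^bold>\<not> \<^bold>\<not> \<alpha> \<tturnstile> (\<^bold>\<not> \<^bold>\<not> \<alpha> \<^bold>\<or> ?G)" using dcons_below[OF or_left] .
    show "\<^bold>\<not> \<^bold>\<circ> \<alpha> \<tturnstile> (\<^bold>\<not> \<^bold>\<not> \<alpha> \<^bold>\<or> ?G)" using dcons_below[OF below_trans[OF that(2) or_right]] .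
  qed
  have "T (\<^bold>\<not> \<^bold>\<not> \<phi> \<^bold>\<or> ?G)"
    using reduce[OF dcons_amp_zero_left below_trans[OF neg_below_imp and_imp_left]] .
  moreover have "T (\<^bold>\<not> \<^bold>\<not> \<psi> \<^bold>\<or> ?G)"
    using reduce[OF dcons_amp_zero_right below_trans[OF neg_below_imp and_imp_right]] .
  ultimately have "T ((\<^bold>\<not> \<^bold>\<not> \<phi> \<^bold>& \<^bold>\<not> \<^bold>\<not> \<psi>) \<^bold>\<or> ?G)" by (rule or_amp)
  then have "T (\<^bold>\<not> \<^bold>\<not> (\<phi> \<^bold>& \<psi>) \<^bold>\<or> ?G)"
    using mp or_mono[OF neg_neg_amp below_refl] by blast
  then have "T (\<^bold>\<circ> (\<phi> \<^bold>& \<psi>) \<^bold>\<or> ?G)" by (rule dense)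
  then show ?thesis using mp or_below[OF weakening below_refl] by blast
qed

end


section \<open>The theorems of a calculus as a theory\<close>

text \<open>
  Axioms and rules may be instantiated with well-formed formulas only. To avoid this side condition
  in every inference, connectives with a wrong number of arguments are replaced by \<open>\<^bold>0\<close>. This
  commutes with the instantiation of well-formed schemata, so that the formulas with derivable image
  contain arbitrary instances of the axioms and are closed under arbitrary instances of the rules.
\<close>
primrec sanitize :: "('c \<Rightarrow> nat option) \<Rightarrow> 'c fm \<Rightarrow> 'c fm" where
  "sanitize ar (Var n) = Var n"
| "sanitize ar \<^bold>0 = \<^bold>0"
| "sanitize ar (\<phi> \<^bold>\<and> \<psi>) = (sanitize ar \<phi> \<^bold>\<and> sanitize ar \<psi>)"
| "sanitize ar (\<phi> \<^bold>& \<psi>) = (sanitize ar \<phi> \<^bold>& sanitize ar \<psi>)"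
| "sanitize ar (\<phi> \<^bold>\<rightarrow> \<psi>) = (sanitize ar \<phi> \<^bold>\<rightarrow> sanitize ar \<psi>)"
| "sanitize ar (Conn c ts) =
     (if ar c = Some (length ts) then Conn c (map (sanitize ar) ts) else \<^bold>0)"

lemma wff_sanitize: "wff ar (sanitize ar \<phi>)"
  by (induction \<phi>) auto

lemma sanitize_wff: "wff ar \<phi> \<Longrightarrow> sanitize ar \<phi> = \<phi>"
  by (induction \<phi>) (auto intro: map_idI)

lemma sanitize_subst: "wff ar \<alpha> \<Longrightarrow> sanitize ar (subst \<sigma> \<alpha>) = subst (sanitize ar \<circ> \<sigma>) \<alpha>"
  by (induction \<alpha>) auto

definition provable :: "'c calculus \<Rightarrow> 'c fm \<Rightarrow> bool" where
  "provable S \<phi> \<longleftrightarrow> derivable S {} (sanitize (arity S) \<phi>)"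

lemma range_sanitize: "range (sanitize (arity S) \<circ> \<sigma>) \<subseteq> Fm S"
  by (auto simp: Fm_def wff_sanitize)

lemma provable_ax: "\<alpha> \<in> axioms S \<Longrightarrow> wff (arity S) \<alpha> \<Longrightarrow> provable S (subst \<sigma> \<alpha>)"
  unfolding provable_def sanitize_subst by (rule derivable.ax[OF _ range_sanitize])

lemma provable_rl:
  assumes "(\<pi>s, \<gamma>) \<in> rules S" "\<forall>\<pi>\<in>set \<pi>s. wff (arity S) \<pi>" "wff (arity S) \<gamma>"
    and "\<forall>\<pi>\<in>set \<pi>s. provable S (subst \<sigma> \<pi>)"
  shows "provable S (subst \<sigma> \<gamma>)"
  using derivable.rl[OF assms(1) range_sanitize[of S \<sigma>]] assms(2-4)
  unfolding provable_def by (simp add: sanitize_subst)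

definition metavars :: "'c fm \<Rightarrow> 'c fm \<Rightarrow> 'c fm \<Rightarrow> nat \<Rightarrow> 'c fm" where
  "metavars \<phi> \<psi> \<chi> n = (if n = 0 then \<phi> else if n = 1 then \<psi> else \<chi>)"

lemma metavars_simps [simp]:
  "metavars \<phi> \<psi> \<chi> 0 = \<phi>" "metavars \<phi> \<psi> \<chi> (Suc 0) = \<psi>" "metavars \<phi> \<psi> \<chi> 2 = \<chi>"
  by (simp_all add: metavars_def)

lemma mtl_theory_provable:
  assumes axs: "mtl_axioms \<subseteq> axioms S" and mp: "modus_ponens \<in> rules S"
  shows "mtl_theory (provable S)"
proof
  note inst = provable_ax[where S = S and \<sigma> = "metavars \<phi> \<psi> \<chi>" for \<phi> \<psi> \<chi>, OF subsetD[OF axs]]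
  fix \<phi> \<psi> \<chi> :: "'a fm"
  show "provable S \<phi> \<Longrightarrow> provable S (\<phi> \<^bold>\<rightarrow> \<psi>) \<Longrightarrow> provable S \<psi>"
    using provable_rl[OF mp[unfolded modus_ponens_def], of "metavars \<phi> \<psi> \<phi>"] by simp
  show "provable S ((\<phi> \<^bold>\<rightarrow> \<psi>) \<^bold>\<rightarrow> ((\<psi> \<^bold>\<rightarrow> \<chi>) \<^bold>\<rightarrow> (\<phi> \<^bold>\<rightarrow> \<chi>)))"
    using inst[of "(Var 0 \<^bold>\<rightarrow> Var 1) \<^bold>\<rightarrow> ((Var 1 \<^bold>\<rightarrow> Var 2) \<^bold>\<rightarrow> (Var 0 \<^bold>\<rightarrow> Var 2))" \<phi> \<psi> \<chi>]
    by (simp add: mtl_axioms_def Let_def)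
  show "provable S ((\<phi> \<^bold>& \<psi>) \<^bold>\<rightarrow> \<phi>)"
    using inst[of "(Var 0 \<^bold>& Var 1) \<^bold>\<rightarrow> Var 0" \<phi> \<psi> \<chi>] by (simp add: mtl_axioms_def Let_def)
  show "provable S ((\<phi> \<^bold>& \<psi>) \<^bold>\<rightarrow> (\<psi> \<^bold>& \<phi>))"
    using inst[of "(Var 0 \<^bold>& Var 1) \<^bold>\<rightarrow> (Var 1 \<^bold>& Var 0)" \<phi> \<psi> \<chi>] by (simp add: mtl_axioms_def Let_def)
  show "provable S ((\<phi> \<^bold>\<and> \<psi>) \<^bold>\<rightarrow> \<phi>)"
    using inst[of "(Var 0 \<^bold>\<and> Var 1) \<^bold>\<rightarrow> Var 0" \<phi> \<psi> \<chi>] by (simp add: mtl_axioms_def Let_def)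
  show "provable S ((\<phi> \<^bold>\<and> \<psi>) \<^bold>\<rightarrow> (\<psi> \<^bold>\<and> \<phi>))"
    using inst[of "(Var 0 \<^bold>\<and> Var 1) \<^bold>\<rightarrow> (Var 1 \<^bold>\<and> Var 0)" \<phi> \<psi> \<chi>] by (simp add: mtl_axioms_def Let_def)
  show "provable S ((\<phi> \<^bold>& (\<phi> \<^bold>\<rightarrow> \<psi>)) \<^bold>\<rightarrow> (\<phi> \<^bold>\<and> \<psi>))"
    using inst[of "(Var 0 \<^bold>& (Var 0 \<^bold>\<rightarrow> Var 1)) \<^bold>\<rightarrow> (Var 0 \<^bold>\<and> Var 1)" \<phi> \<psi> \<chi>]
    by (simp add: mtl_axioms_def Let_def)
  show "provable S ((\<phi> \<^bold>\<rightarrow> (\<psi> \<^bold>\<rightarrow> \<chi>)) \<^bold>\<rightarrow> ((\<phi> \<^bold>& \<psi>) \<^bold>\<rightarrow> \<chi>))"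
    using inst[of "(Var 0 \<^bold>\<rightarrow> (Var 1 \<^bold>\<rightarrow> Var 2)) \<^bold>\<rightarrow> ((Var 0 \<^bold>& Var 1) \<^bold>\<rightarrow> Var 2)" \<phi> \<psi> \<chi>]
    by (simp add: mtl_axioms_def Let_def)
  show "provable S (((\<phi> \<^bold>& \<psi>) \<^bold>\<rightarrow> \<chi>) \<^bold>\<rightarrow> (\<phi> \<^bold>\<rightarrow> (\<psi> \<^bold>\<rightarrow> \<chi>)))"
    using inst[of "((Var 0 \<^bold>& Var 1) \<^bold>\<rightarrow> Var 2) \<^bold>\<rightarrow> (Var 0 \<^bold>\<rightarrow> (Var 1 \<^bold>\<rightarrow> Var 2))" \<phi> \<psi> \<chi>]
    by (simp add: mtl_axioms_def Let_def)
  show "provable S (((\<phi> \<^bold>\<rightarrow> \<psi>) \<^bold>\<rightarrow> \<chi>) \<^bold>\<rightarrow> (((\<psi> \<^bold>\<rightarrow> \<phi>) \<^bold>\<rightarrow> \<chi>) \<^bold>\<rightarrow> \<chi>))"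
    using inst[of "((Var 0 \<^bold>\<rightarrow> Var 1) \<^bold>\<rightarrow> Var 2) \<^bold>\<rightarrow> (((Var 1 \<^bold>\<rightarrow> Var 0) \<^bold>\<rightarrow> Var 2) \<^bold>\<rightarrow> Var 2)"
        \<phi> \<psi> \<chi>]
    by (simp add: mtl_axioms_def Let_def)
  show "provable S (\<^bold>0 \<^bold>\<rightarrow> \<phi>)"
    using inst[of "\<^bold>0 \<^bold>\<rightarrow> Var 0" \<phi> \<psi> \<chi>] by (simp add: mtl_axioms_def Let_def)
qed

lemma rename_mtl: "map_fm Old ` mtl_axioms = mtl_axioms"
  by (simp add: mtl_axioms_def Let_def)

lemma rename_modus_ponens: "map_prod (map (map_fm Old)) (map_fm Old) modus_ponens = modus_ponens"
  by (simp add: modus_ponens_def)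

lemma consistency_theory_provable:
  assumes core: "core_expansion L"
    and ar: "arity S = arity (circ_logic L)"
    and axs: "axioms (circ_logic L) \<subseteq> axioms S" and rls: "rules (circ_logic L) \<subseteq> rules S"
  shows "consistency_theory (provable S)"
proof -
  have "map_fm Old ` mtl_axioms \<subseteq> axioms (circ_logic L)"
    using core by (auto simp: core_expansion_def circ_logic_def Let_def)
  then have mtl: "mtl_axioms \<subseteq> axioms S" using axs by (simp add: rename_mtl)
  have "map_prod (map (map_fm Old)) (map_fm Old) modus_ponens \<in> rules (circ_logic L)"
    using core by (auto simp: core_expansion_def circ_logic_def Let_def)
  then have mp: "modus_ponens \<in> rules S" using rls by (auto simp: rename_modus_ponens)
  have arc [simp]: "arity S Circ = Some (Suc 0)" by (simp add: ar circ_logic_def Let_def)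
  note unfold = Neg_def One_def Or_def Iff_def
  have ax1: "\<^bold>\<not> (Var 0 \<^bold>\<and> \<^bold>\<not> Var 0 \<^bold>\<and> \<^bold>\<circ> (Var 0)) \<in> axioms S"
    and ax2: "\<^bold>\<circ> \<^bold>1 \<in> axioms S" and ax3: "\<^bold>\<circ> \<^bold>0 \<in> axioms S"
    using axs by (auto simp: circ_logic_def Let_def)
  have cong: "([(Var 0 \<^bold>\<leftrightarrow> Var 1) \<^bold>\<or> Var 2],
      (\<^bold>\<circ> (Var 0) \<^bold>\<leftrightarrow> \<^bold>\<circ> (Var 1)) \<^bold>\<or> Var 2) \<in> rules S"
    and coh: "([(\<^bold>\<not> \<^bold>\<not> (Var 0) \<^bold>\<and> (Var 0 \<^bold>\<rightarrow> Var 1)) \<^bold>\<or> Var 2],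
      (\<^bold>\<circ> (Var 0) \<^bold>\<rightarrow> \<^bold>\<circ> (Var 1)) \<^bold>\<or> Var 2) \<in> rules S"
    using rls by (auto simp: circ_logic_def Let_def)
  interpret mtl_theory "provable S" using mtl mp by (rule mtl_theory_provable)
  show ?thesis
  proof
    fix \<phi> \<psi> \<delta> :: "'a with_circ fm"
    show "provable S (\<^bold>\<not> (\<phi> \<^bold>\<and> \<^bold>\<not> \<phi> \<^bold>\<and> \<^bold>\<circ> \<phi>))"
      using provable_ax[OF ax1, of "metavars \<phi> \<psi> \<delta>"] by (simp add: unfold)
    show "provable S (\<^bold>\<circ> \<^bold>1)"
      using provable_ax[OF ax2, of "metavars \<phi> \<psi> \<delta>"] by (simp add: unfold)
    show "provable S (\<^bold>\<circ> \<^bold>0)"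
      using provable_ax[OF ax3, of "metavars \<phi> \<psi> \<delta>"] by simp
    show "provable S ((\<phi> \<^bold>\<leftrightarrow> \<psi>) \<^bold>\<or> \<delta>) \<Longrightarrow> provable S ((\<^bold>\<circ> \<phi> \<^bold>\<leftrightarrow> \<^bold>\<circ> \<psi>) \<^bold>\<or> \<delta>)"
      using provable_rl[OF cong, of "metavars \<phi> \<psi> \<delta>"] by (simp add: unfold)
    show "provable S ((\<^bold>\<not> \<^bold>\<not> \<phi> \<^bold>\<and> (\<phi> \<^bold>\<rightarrow> \<psi>)) \<^bold>\<or> \<delta>) \<Longrightarrow> provable S ((\<^bold>\<circ> \<phi> \<^bold>\<rightarrow> \<^bold>\<circ> \<psi>) \<^bold>\<or> \<delta>)"
      using provable_rl[OF coh, of "metavars \<phi> \<psi> \<delta>"] by (simp add: unfold)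
  qed
qed

lemma propagation_property_provable:
  assumes ar: "arity S = arity (circ_logic L)" and "ops \<subseteq> {And, Amp, Imp}"
    and prov: "\<And>c \<phi> \<psi>. c \<in> ops \<Longrightarrow> provable S ((\<^bold>\<circ> \<phi> \<^bold>\<and> \<^bold>\<circ> \<psi>) \<^bold>\<rightarrow> \<^bold>\<circ> (c \<phi> \<psi>))"
  shows "propagation_property S ops"
  unfolding propagation_property_def
proof (intro ballI)
  fix c \<phi> \<psi> assume c: "c \<in> ops" and "\<phi> \<in> Fm S" "\<psi> \<in> Fm S"
  moreover have "arity S Circ = Some 1" by (simp add: ar circ_logic_def Let_def)
  ultimately have "wff (arity S) ((\<^bold>\<circ> \<phi> \<^bold>\<and> \<^bold>\<circ> \<psi>) \<^bold>\<rightarrow> \<^bold>\<circ> (c \<phi> \<psi>))"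
    using assms(2) by (auto simp: Fm_def)
  then show "derivable S {} ((\<^bold>\<circ> \<phi> \<^bold>\<and> \<^bold>\<circ> \<psi>) \<^bold>\<rightarrow> \<^bold>\<circ> (c \<phi> \<psi>))"
    using prov[OF c] unfolding provable_def by (metis sanitize_wff)
qed


section \<open>Propagation\<close>

theorem proposition5p2:
  fixes L :: "'c calculus"
  assumes "core_expansion L" and "semilinear L" and "\<not> smtl_logic L"
  shows "propagation_property (circ_logic L) {And, Imp} \<and>
         (\<forall>S \<in> {circ_logic_nn L, circ_logic_min L, circ_logic_max L}.
            propagation_property S {And, Amp, Imp})"
proof -
  note consistency = consistency_theory_provable[OF assms(1)]
  interpret base: consistency_theory "provable (circ_logic L)"
    by (rule consistency) auto
  interpret nn: consistency_theory "provable (circ_logic_nn L)"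
    by (rule consistency) (auto simp: circ_logic_nn_def)
  interpret mn: consistency_theory "provable (circ_logic_min L)"
    by (rule consistency) (auto simp: circ_logic_min_def)
  interpret mx: consistency_theory "provable (circ_logic_max L)"
    by (rule consistency) (auto simp: circ_logic_max_def)
  have ar: "arity (circ_logic_nn L) = arity (circ_logic L)"
    "arity (circ_logic_min L) = arity (circ_logic L)"
    "arity (circ_logic_max L) = arity (circ_logic L)"
    by (simp_all add: circ_logic_nn_def circ_logic_min_def circ_logic_max_def)
  have arc: "arity (circ_logic L) Circ = Some (Suc 0)"
    by (simp add: circ_logic_def Let_def)
  have nn: "provable (circ_logic_nn L) \<alpha>" if "provable (circ_logic_nn L) (\<^bold>\<not> \<^bold>\<not> \<alpha>)" for \<alpha>
    using that provable_rl[of "[\<^bold>\<not> \<^bold>\<not> (Var 0)]" "Var 0" "circ_logic_nn L" "\<lambda>_. \<alpha>"]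
    by (simp add: Neg_def circ_logic_nn_def)
  have mn: "provable (circ_logic_min L) (\<phi> \<^bold>\<or> \<^bold>\<not> \<phi> \<^bold>\<or> \<^bold>\<not> \<^bold>\<circ> \<phi>)" for \<phi>
  proof -
    let ?\<alpha> = "Var 0 \<^bold>\<or> \<^bold>\<not> (Var 0) \<^bold>\<or> \<^bold>\<not> \<^bold>\<circ> (Var 0)"
    have "?\<alpha> \<in> axioms (circ_logic_min L)" by (simp add: circ_logic_min_def)
    moreover have "wff (arity (circ_logic_min L)) ?\<alpha>" by (simp add: ar arc Or_def Neg_def)
    ultimately have "provable (circ_logic_min L) (subst (\<lambda>_. \<phi>) ?\<alpha>)" by (rule provable_ax)
    then show ?thesis by (simp add: Or_def Neg_def)
  qed
  have mx: "provable (circ_logic_max L) (\<^bold>\<circ> \<alpha> \<^bold>\<or> \<delta>)"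
    if "provable (circ_logic_max L) (\<^bold>\<not> \<^bold>\<not> \<alpha> \<^bold>\<or> \<delta>)" for \<alpha> \<delta>
  proof -
    have "([\<^bold>\<not> \<^bold>\<not> (Var 0) \<^bold>\<or> Var 1], \<^bold>\<circ> (Var 0) \<^bold>\<or> Var 1) \<in> rules (circ_logic_max L)"
      by (simp add: circ_logic_max_def)
    from provable_rl[OF this, of "metavars \<alpha> \<delta> \<delta>"] that show ?thesis
      by (simp add: ar arc Or_def Neg_def)
  qed
  have "propagation_property (circ_logic L) {And, Imp}"
    by (rule propagation_property_provable[OF refl])
      (auto intro: base.propagation_and base.propagation_imp)
  moreover have "propagation_property (circ_logic_nn L) {And, Amp, Imp}"
    by (rule propagation_property_provable[OF ar(1)])
      (auto intro: nn.propagation_and nn.propagation_imp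
        nn.propagation_amp_of_sharp_trichotomy nn.sharp_trichotomy_of_double_negation nn)
  moreover have "propagation_property (circ_logic_min L) {And, Amp, Imp}"
    by (rule propagation_property_provable[OF ar(2)])
      (auto intro: mn.propagation_and mn.propagation_imp
        mn.propagation_amp_of_sharp_trichotomy mn)
  moreover have "propagation_property (circ_logic_max L) {And, Amp, Imp}"
    by (rule propagation_property_provable[OF ar(3)])
      (auto intro: mx.propagation_and mx.propagation_imp mx.propagation_amp_of_dense_circ mx)
  ultimately show ?thesis by blast
qed

end
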